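(* Let $(D,S)$ be a relational system on $A$ satisfying Condition 1 and let $R_1,\dots,R_M\subseteq A$ ($M\ge 2$) satisfy Condition 2 (both conditions are spelled out in the context). The descending assignment rule fulfills the following properties: (i) each $w\in R_M$ is assigned to $C_M$; (ii) for each $k<M$ ($1\le k\le M-1$), each $w\in R_k$ is assigned to a class within the range $C_k - C_{k+1}$ (that is, the rule selects $C_k$ and $C_{k+1}$ as the possible categories for $w$).
   Context: $A$ is the set of actions (all actions to be classified and all representative actions). $C=\{C_1,\dots,C_M\}$, $M\ge 2$, is a set of ordered classes, $C_M$ being the highest. Condition 1: $D$ and $S$ are binary relations on $A$ such that $D$ is transitive, $S$ is reflexive, and for all $x,y,z\in A$: $xDy\Rightarrow xSy$; ($xSy$ and $yDz$) $\Rightarrow xSz$; ($xDy$ and $ySz$) $\Rightarrow xSz$. ($S$ is also interpreted as "compatible with the order of the classes", i.e. $xSy$ is an argument for putting $x$ in a class at least as high as $y$; this is interpretive and imposes no further formal constraint.) Condition 2: each class $C_k$ is characterized by a nonempty finite set $R_k\subseteq A$ of representative actions such that (a) for $k=1,\dots,M-1$ and every $w\in R_k$ there is $z\in R_{k+1}$ with $zDw$; (b) for $k=1,\dots,M-1$ and every $w\in R_{k+1}$ there is $z\in R_k$ with $wDz$; (c) for all $1\le k<h\le M$ and every $w\in R_h$ there is no $z\in R_k$ with $zSw$. Notation: $xSR_k$ iff there is $z\in R_k$ with $xSz$. Descending assignment rule: by convention $xSR_0$ holds for all $x$. For $k=M,M-1,\dots,0$ determine the first $k$ (i.e. the largest)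 such that $xSR_k$. If $k=M$, assign $x$ to $C_M$; if $k=0$, assign $x$ to $C_1$; if $0<k<M$, select $C_k$ and $C_{k+1}$ as the possible categories for $x$ ($x$ is assigned to the range $C_k-C_{k+1}$). *)

theory Defs
  imports Main
begin

definition condition1 :: "'a set \<Rightarrow> 'a rel \<Rightarrow> 'a rel \<Rightarrow> bool" where
  "condition1 A D S \<longleftrightarrow>
     D \<subseteq> A \<times> A \<and> S \<subseteq> A \<times> A \<and> trans D \<and> refl_on A S \<and>
     (\<forall>x\<in>A. \<forall>y\<in>A. (x, y) \<in> D \<longrightarrow> (x, y) \<in> S) \<and>
     (\<forall>x\<in>A. \<forall>y\<in>A. \<forall>z\<in>A. (x, y) \<in> S \<and> (y, z) \<in> D \<longrightarrow> (x, z) \<in> S) \<and>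
     (\<forall>x\<in>A. \<forall>y\<in>A. \<forall>z\<in>A. (x, y) \<in> D \<and> (y, z) \<in> S \<longrightarrow> (x, z) \<in> S)"

(* The class C_k is represented by its index k, with M the highest class; only R 1, ..., R M
   are constrained. *)
definition condition2 :: "'a set \<Rightarrow> 'a rel \<Rightarrow> 'a rel \<Rightarrow> nat \<Rightarrow> (nat \<Rightarrow> 'a set) \<Rightarrow> bool" where
  "condition2 A D S M R \<longleftrightarrow>
     (\<forall>k\<in>{1..M}. R k \<subseteq> A \<and> finite (R k) \<and> R k \<noteq> {}) \<and>
     (\<forall>k\<in>{1..<M}. \<forall>w\<in>R k. \<exists>z\<in>R (k + 1). (z, w) \<in> D) \<and>
     (\<forall>k\<in>{1..<M}. \<forall>w\<in>R (k + 1). \<exists>z\<in>R k. (w, z) \<in> D) \<and>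
     (\<forall>k h. 1 \<le> k \<and> k < h \<and> h \<le> M \<longrightarrow> (\<forall>w\<in>R h. \<not> (\<exists>z\<in>R k. (z, w) \<in> S)))"

(* x S R_k, with the convention that x S R_0 always holds, whatever the value R 0. *)
definition rel_class :: "'a rel \<Rightarrow> (nat \<Rightarrow> 'a set) \<Rightarrow> 'a \<Rightarrow> nat \<Rightarrow> bool" where
  "rel_class S R x k \<longleftrightarrow> k = 0 \<or> (\<exists>z\<in>R k. (x, z) \<in> S)"

definition descending_index :: "'a rel \<Rightarrow> nat \<Rightarrow> (nat \<Rightarrow> 'a set) \<Rightarrow> 'a \<Rightarrow> nat" where
  "descending_index S M R x = Max {k. k \<le> M \<and> rel_class S R x k}"

(* The set of (indices of) classes selected for x: a singleton if x is assigned to one class,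
   and {k, k + 1} if x is assigned to the range from C_k to C_(k+1). *)
definition descending_assignment :: "'a rel \<Rightarrow> nat \<Rightarrow> (nat \<Rightarrow> 'a set) \<Rightarrow> 'a \<Rightarrow> nat set" where
  "descending_assignment S M R x =
     (let k = descending_index S M R x in
      if k = M then {M} else if k = 0 then {1} else {k, k + 1})"

end

theory Submission
  imports Defs
begin

text \<open>A representative \<open>w\<close> of class \<open>k\<close> stops the descending scan
  exactly at \<open>k\<close>. Reflexivity of \<open>S\<close> makes \<open>w\<close> its own
  witness for \<open>R k\<close>, so \<open>k\<close> qualifies; part (c) of
  \<open>condition2\<close> forbids \<open>w\<close> to stand in relation \<open>S\<close> to any
  representative of a higher class, so nothing above \<open>k\<close> qualifies.
  \<open>descending_index_representative\<close> records this, and the assignment is then read off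
  from the index.\<close>

lemma descending_index_representative:
  assumes "condition1 A D S" and "condition2 A D S M R"
    and "1 \<le> k" and "k \<le> M" and "w \<in> R k"
  shows "descending_index S M R w = k"
  unfolding descending_index_def
proof (rule Max_eqI)
  show "finite {j. j \<le> M \<and> rel_class S R w j}"
    by simp
next
  have "w \<in> A"
    using assms(2-5) by (auto simp: condition2_def)
  then have "(w, w) \<in> S"
    using assms(1) by (auto simp: condition1_def refl_on_def)
  then show "k \<in> {j. j \<le> M \<and> rel_class S R w j}"
    using assms(4,5) by (auto simp: rel_class_def)
next
  fix j
  assume "j \<in> {j. j \<le> M \<and> rel_class S R w j}"
  then have "j \<le> M" and rel: "rel_class S R w j"
    by auto
  show "j \<le> k"
  proof (rule ccontr)
    assume "\<not> j \<le> k"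
    then have "k < j"
      by simp
    \<comment> \<open>Since \<open>j > k\<close>, \<open>j\<close> is nonzero, so the convention for
      \<open>R 0\<close> cannot be what makes \<open>rel_class\<close> true and a genuine witness
      exists.\<close>
    then obtain z where "z \<in> R j" and "(w, z) \<in> S"
      using rel by (auto simp: rel_class_def)
    moreover have "\<forall>z\<in>R j. \<not> (\<exists>v\<in>R k. (v, z) \<in> S)"
      using assms(2,3) \<open>k < j\<close> \<open>j \<le> M\<close> unfolding condition2_def by blast
    ultimately show False
      using assms(5) by blast
  qed
qed

theorem proposition2:
  fixes A :: "'a set" and D S :: "'a rel" and M :: nat and R :: "nat \<Rightarrow> 'a set"
  assumes "condition1 A D S"
    and "M \<ge> 2"
    and "condition2 A D S M R"
  shows "(\<forall>w\<in>R M. descending_assignment S M R w = {M}) \<and>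
         (\<forall>k. 1 \<le> k \<and> k \<le> M - 1 \<longrightarrow>
            (\<forall>w\<in>R k. descending_assignment S M R w = {k, k + 1}))"
  \<comment> \<open>The index is \<open>M\<close> or lies strictly between 0 and \<open>M\<close>,
    so the branch for index 0 never applies; \<open>M \<ge> 2\<close> gives the bound
    \<open>1 \<le> M\<close> for the top class.\<close>
  using assms(2) descending_index_representative[OF assms(1,3)]
  by (auto simp: descending_assignment_def Let_def)

end
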